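(* Let $K$ be a field of characteristic $0$ and let $F : K^n \to K^n$ be an invertible polynomial map of the form $F = x + H$, where $H$ is power linear of degree $d$, i.e. $H = (Ax)^{*d}$ for some $n\times n$ matrix $A$ over $K$ and an integer $d\ge 1$. If $\operatorname{rk} \mathcal{J} H = r$, then the inverse polynomial map of $F$ has degree at most $d^r$.
   Context: A polynomial map $F : K^n \to K^n$ is a tuple $F = (F_1,\ldots,F_n)$ of polynomials $F_i \in K[x_1,\ldots,x_n]$; its degree is $\max_i \deg F_i$ (total degree). $x = (x_1,\ldots,x_n)$ denotes the identity map (also viewed as a column vector). $F$ is invertible if it has an inverse that is a polynomial map (a two-sided inverse for composition). $(Ax)^{*d}$ denotes the $d$-th Hadamard (entrywise) power of the vector of linear forms $Ax$, i.e. its $i$-th component is $(A_{i1}x_1 + \cdots + A_{in}x_n)^d$. $\mathcal{J} H = \left(\frac{\partial H_i}{\partial x_j}\right)_{i,j}$ is the Jacobian matrix, and its rank is taken over the field $K(x_1,\ldots,x_n)$. *)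

theory Defs
  imports
    "HOL-Analysis.Cartesian_Space"
    "HOL-Library.Poly_Mapping"
    "HOL-Computational_Algebra.Fraction_Field"
begin

text \<open>
  The index type \<open>'n\<close> plays the role of \<open>{1, \<dots>, n}\<close>. A polynomial in the variables
  \<open>x\<^sub>i\<close> (\<open>i :: 'n\<close>) maps exponent vectors to coefficients. The fraction field is available for
  index types of class \<open>linorder\<close>, because the library derives the absence of zero divisors
  from a linear order on exponent vectors. The order is used for nothing else.
\<close>

type_synonym ('n, 'k) mpoly = "('n \<Rightarrow>\<^sub>0 nat) \<Rightarrow>\<^sub>0 'k"

type_synonym ('n, 'k) polymap = "('n, 'k) mpoly ^ 'n"

type_synonym ('n, 'a) sqmat = "'a ^ 'n ^ 'n"

definition Const :: "'k \<Rightarrow> ('n, 'k::zero) mpoly"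
  where "Const c = Poly_Mapping.single 0 c"

definition Var :: "'n \<Rightarrow> ('n, 'k::zero_neq_one) mpoly"
  where "Var i = Poly_Mapping.single (Poly_Mapping.single i 1) 1"

text \<open>The zero polynomial gets degree \<open>0\<close>.\<close>

definition total_degree :: "('n::finite, 'k::zero) mpoly \<Rightarrow> nat"
  where "total_degree p =
    Max (insert 0 ((\<lambda>m. \<Sum>i\<in>UNIV. Poly_Mapping.lookup m i) ` Poly_Mapping.keys p))"

definition polymap_degree :: "('n::finite, 'k::zero) polymap \<Rightarrow> nat"
  where "polymap_degree F = Max (range (\<lambda>i. total_degree (F $ i)))"

definition id_polymap :: "('n::finite, 'k::zero_neq_one) polymap"
  where "id_polymap = (\<chi> i. Var i)"

definition poly_subst :: "('n::finite, 'k::comm_semiring_1) mpoly \<Rightarrow> ('n, 'k) polymap \<Rightarrow> ('n, 'k) mpoly"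
  where "poly_subst p G = (\<Sum>m\<in>Poly_Mapping.keys p.
    Const (Poly_Mapping.lookup p m) * (\<Prod>i\<in>UNIV. (G $ i) ^ Poly_Mapping.lookup m i))"

definition polymap_comp :: "('n::finite, 'k::comm_semiring_1) polymap \<Rightarrow> ('n, 'k) polymap \<Rightarrow> ('n, 'k) polymap"
  where "polymap_comp F G = (\<chi> i. poly_subst (F $ i) G)"

definition is_polymap_inverse :: "('n::finite, 'k::comm_semiring_1) polymap \<Rightarrow> ('n, 'k) polymap \<Rightarrow> bool"
  where "is_polymap_inverse F G \<longleftrightarrow>
    polymap_comp F G = id_polymap \<and> polymap_comp G F = id_polymap"

text \<open>
  Subtraction of exponents is truncated, but a monomial not containing \<open>x\<^sub>j\<close> gets
  coefficient \<open>0\<close>.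
\<close>

definition partial_deriv :: "'n \<Rightarrow> ('n, 'k::semiring_1) mpoly \<Rightarrow> ('n, 'k) mpoly"
  where "partial_deriv j p = (\<Sum>m\<in>Poly_Mapping.keys p.
    Poly_Mapping.single (m - Poly_Mapping.single j 1)
      (of_nat (Poly_Mapping.lookup m j) * Poly_Mapping.lookup p m))"

definition jacobian :: "('n::finite, 'k::semiring_1) polymap \<Rightarrow> ('n, ('n, 'k) mpoly) sqmat"
  where "jacobian H = (\<chi> i j. partial_deriv j (H $ i))"

text \<open>Rank over the field of rational functions.\<close>

definition poly_matrix_rank :: "('n::{finite,linorder}, ('n, 'k::field) mpoly) sqmat \<Rightarrow> nat"
  where "poly_matrix_rank M = rank (\<chi> i j. Fract (M $ i $ j) 1)"

definition linear_forms :: "('n::finite, 'k::comm_semiring_1) sqmat \<Rightarrow> ('n, 'k) polymap"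
  where "linear_forms A = (\<chi> i j. Const (A $ i $ j)) *v id_polymap"

definition hadamard_power :: "('n::finite, 'k::comm_semiring_1) polymap \<Rightarrow> nat \<Rightarrow> ('n, 'k) polymap"
  where "hadamard_power F d = (\<chi> i. (F $ i) ^ d)"

end

(*
  The idea is to compare Hilbert functions. Choose linear coordinates T in which A T involves only the
  variables from a set S of size rk A. Since JH = d diag((A_i x)^(d-1)) A, where the diagonal entry
  vanishes only if the i-th row of A does, rk A is at most rk JH. Give these variables weight 1 and
  the other ones weight d. Then all components of F o T have weighted degree at most d, and
  substituting F o T is an automorphism phi of the polynomial ring which sends P = G_i to the linear
  form (T x)_i, again of weighted degree at most d.

  Let delta be the degree of P. The images under phi of the monomials of degree at most D that are
  not divisible by the leading monomial of P, together with the multiples of phi(P) by monomials of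
  weight at most dD - d, are linearly independent polynomials of weighted degree at most dD, because
  no nonzero multiple of P avoids multiples of its leading monomial. With h(k) the number of
  monomials of degree k, counting gives delta h(D - delta) <= d^|S| h(D) for all D >= delta. As h
  grows only polynomially, delta <= d^|S|.
*)

theory Submission
  imports Defs
begin

declare One_nat_def [simp del]

section \<open>Matrix rank over a field\<close>

lemma rank_mult_le_right:
  fixes A :: "'a::field^'n^'m" and B :: "'a^'p^'n"
  shows "rank (A ** B) \<le> rank B"
proof -
  have "rows (A ** B) \<subseteq> vec.span (rows B)"
  proof
    fix v assume "v \<in> rows (A ** B)"
    then obtain i where v: "v = row i (A ** B)"
      by (auto simp: rows_def)
    have "v = (\<Sum>k\<in>UNIV. A $ i $ k *s row k B)"
      by (simp add: v vec_eq_iff row_def matrix_matrix_mult_def)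
    also have "\<dots> \<in> vec.span (rows B)"
      by (intro vec.span_sum vec.span_scale vec.span_base) (auto simp: rows_def)
    finally show "v \<in> vec.span (rows B)" .
  qed
  then show ?thesis
    unfolding row_rank_def_gen by (rule vec.dim_mono)
qed

lemma rank_mult_le_left:
  fixes A :: "'a::field^'n^'m" and B :: "'a^'p^'n"
  shows "rank (A ** B) \<le> rank A"
proof -
  have "rows (A ** B) = (*v) (transpose B) ` rows A"
    by (force simp: rows_def row_def matrix_matrix_mult_def matrix_vector_mult_def transpose_def
        mult.commute image_def vec_eq_iff)
  then show ?thesis
    unfolding row_rank_def_gen by (metis matrix_vector_mul_linear_gen vec.dim_image_le)
qed

definition coord_proj :: "'n set \<Rightarrow> ('n::finite, 'a::zero_neq_one) sqmat"
  where "coord_proj S = (\<chi> i j. if i = j \<and> i \<in> S then 1 else 0)"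

lemma card_le_rank_coord_proj: "card S \<le> rank (coord_proj S :: ('n::finite, 'a::field) sqmat)"
proof -
  let ?B = "(\<lambda>i. axis i 1) ` S :: ('a ^ 'n) set"
  have "?B \<subseteq> rows (coord_proj S :: ('n::finite, 'a::field) sqmat)"
    by (auto simp: rows_def row_def coord_proj_def axis_def vec_eq_iff intro!: exI)
  moreover have "vec.independent ?B"
    by (rule vec.independent_mono[OF independent_cart_basis]) (auto simp: cart_basis_def)
  ultimately have "card ?B \<le> rank (coord_proj S :: ('n::finite, 'a::field) sqmat)"
    unfolding row_rank_def_gen by (rule vec.independent_card_le_dim)
  moreover have "card ?B = card S"
    by (rule card_image) (auto simp: inj_on_def axis_def vec_eq_iff split: if_splits)
  ultimately show ?thesis by simp
qed

text \<open>Extend a basis of the kernel of \<open>A\<close> to a basis of the whole space and use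
  it as the columns of \<open>T\<close>. The set \<open>S\<close> indexes the basis vectors outside
  the kernel, on whose span \<open>A\<close> is injective. The identity with \<open>L\<close>
  certifies that \<open>A\<close> has rank at least \<open>card S\<close>; being a matrix identity,
  it survives an extension of scalars.\<close>

lemma rank_normal_form:
  fixes A :: "('n::finite, 'a::field) sqmat"
  obtains T T' L :: "('n, 'a) sqmat" and S where "T ** T' = mat 1" "T' ** T = mat 1"
    "\<forall>i j. j \<notin> S \<longrightarrow> (A ** T) $ i $ j = 0" "L ** A ** T = coord_proj S"
proof -
  define N where "N = {x. A *v x = 0}"
  have subN: "vec.subspace N"
    unfolding N_def by (auto simp: vec.subspace_def matrix_vector_right_distrib vector_scalar_commute)
  obtain B0 where B0: "B0 \<subseteq> N" "vec.independent B0" "vec.span B0 = N"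
    using vec.basis_exists[of N] vec.span_subspace[OF _ _ subN] by metis
  obtain B where B: "B0 \<subseteq> B" "vec.independent B" "vec.span B = UNIV"
    using vec.maximal_independent_subset_extend[OF subset_UNIV B0(2)] by (metis UNIV_I subsetI subset_antisym)
  have finB: "finite B" using B(2) by (rule vec.finiteI_independent)
  have "card B = CARD('n)"
    using vec.dim_eq_card[of B UNIV] B by (simp add: vec_dim_card card_cart_basis)
  then obtain t where t: "bij_betw t (UNIV :: 'n set) B"
    using finB by (metis finite_class.finite_UNIV finite_same_card_bij)
  define T :: "('n, 'a) sqmat" where "T = (\<chi> i j. t j $ i)"
  define S where "S = {j. t j \<notin> B0}"
  have tB: "range t = B"
    using t by (auto simp: bij_betw_def)
  have col: "column j T = t j" for j
    by (simp add: T_def column_def)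
  have Tax: "T *v axis j 1 = t j" for j
    by (simp add: vec_eq_iff matrix_vector_mult_def T_def axis_def if_distrib cong: if_cong)
  have "columns T = B"
    using tB by (auto simp: columns_def col)
  then obtain T' where T': "T ** T' = mat 1"
    using B(3) matrix_right_invertible_span_columns[of T] by auto
  then have T'': "T' ** T = mat 1"
    by (simp add: matrix_left_right_inverse)
  have T't: "T' *v t j = axis j 1" for j
    by (simp add: Tax[symmetric] matrix_vector_mul_assoc T'')
  \<comment> \<open>This is the span of the \<open>t j\<close> with \<open>j \<in> S\<close>,
    described by coordinates with respect to the basis \<open>t\<close>. By \<open>N_supp\<close> it
    meets the kernel \<open>N\<close> only in \<open>0\<close>.\<close>
  define V where "V = {x. \<forall>j. j \<notin> S \<longrightarrow> (T' *v x) $ j = 0}"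
  have subV: "vec.subspace V"
    unfolding V_def by (auto simp: vec.subspace_def matrix_vector_right_distrib vector_scalar_commute)
  have N_supp: "(T' *v x) $ j = 0" if "x \<in> N" "j \<in> S" for x j
  proof -
    have "vec.subspace {x. (T' *v x) $ j = 0}"
      by (auto simp: vec.subspace_def matrix_vector_right_distrib vector_scalar_commute)
    moreover have "B0 \<subseteq> {x. (T' *v x) $ j = 0}"
    proof
      fix b assume b: "b \<in> B0"
      then obtain k where "b = t k" using B(1) tB by auto
      moreover from this have "k \<noteq> j" using b \<open>j \<in> S\<close> by (auto simp: S_def)
      ultimately show "b \<in> {x. (T' *v x) $ j = 0}" by (simp add: T't axis_def)
    qed
    ultimately show ?thesis
      using vec.span_minimal[of B0] B0(3) \<open>x \<in> N\<close> by auto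
  qed
  have inj: "inj_on ((*v) A) V"
  proof (rule inj_onI)
    fix x y assume xy: "x \<in> V" "y \<in> V" "A *v x = A *v y"
    then have "x - y \<in> V" "x - y \<in> N"
      using subV by (auto simp: vec.subspace_diff N_def matrix_vector_mult_diff_distrib)
    then have "T' *v (x - y) = 0"
      using N_supp by (force simp: V_def vec_eq_iff)
    then have "T *v (T' *v (x - y)) = 0" by simp
    then show "x = y" by (simp add: matrix_vector_mul_assoc T')
  qed
  obtain g where g: "Vector_Spaces.linear (*s) (*s) g" "\<And>x. x \<in> V \<Longrightarrow> g (A *v x) = x"
    using vec.linear_exists_left_inverse_on[OF matrix_vector_mul_linear_gen subV inj] by blast
  \<comment> \<open>For \<open>j \<in> S\<close>, \<open>g\<close> recovers \<open>t j\<close> from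
    \<open>A *v t j\<close>, and \<open>T'\<close> turns it into the unit vector
    \<open>axis j 1\<close>.\<close>
  define L where "L = T' ** matrix g"
  have L: "L *v y = T' *v g y" for y
    by (simp add: L_def matrix_works g(1) flip: matrix_vector_mul_assoc)
  have At: "A *v t j = 0" if "j \<notin> S" for j
    using that B0(1) by (auto simp: S_def N_def)
  have ent: "(M ** T) $ i $ j = (M *v t j) $ i" for M :: "('n, 'a) sqmat" and i j
    by (simp add: matrix_matrix_mult_def matrix_vector_mult_def T_def)
  have "g 0 = 0" using g(2)[of 0] subV by (simp add: vec.subspace_0)
  have LA: "(L *v (A *v t j)) $ i = coord_proj S $ i $ j" for i j
  proof (cases "j \<in> S")
    case True
    then have "t j \<in> V" by (auto simp: V_def T't axis_def)
    then show ?thesis using True by (auto simp: L g(2) T't axis_def coord_proj_def)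
  next
    case False
    then show ?thesis by (auto simp: At L \<open>g 0 = 0\<close> coord_proj_def)
  qed
  show ?thesis
  proof (rule that[of T T' S L])
    show "\<forall>i j. j \<notin> S \<longrightarrow> (A ** T) $ i $ j = 0"
      by (simp add: ent At)
    show "L ** A ** T = coord_proj S"
      by (simp add: vec_eq_iff ent LA flip: matrix_vector_mul_assoc)
  qed fact+
qed

section \<open>Substitution\<close>

lemma Const_0 [simp]: "Const 0 = 0"
  and Const_1 [simp]: "Const 1 = 1"
  and Const_add: "Const (a + b) = Const a + Const b"
  by (simp_all add: Const_def single_add)

lemma Const_eq_0_iff [simp]: "Const c = 0 \<longleftrightarrow> c = 0"
  by (metis Const_0 Const_def lookup_single_eq lookup_zero)

lemma Const_uminus: "Const (- a) = - Const (a :: 'k::ab_group_add)"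
  by (simp add: Const_def single_uminus)

lemma Const_mult: "Const (a * b) = Const a * Const (b :: 'k::comm_semiring_1)"
  by (simp add: Const_def mult_single)

lemma Const_sum: "Const (\<Sum>i\<in>I. f i) = (\<Sum>i\<in>I. Const (f i :: 'k::comm_semiring_1))"
  by (induction I rule: infinite_finite_induct) (simp_all add: Const_add)

lemma Const_mult_single: "Const c * Poly_Mapping.single m a = Poly_Mapping.single m (c * a :: 'k::comm_semiring_1)"
  by (simp add: Const_def mult_single)

lemma poly_eq_sum_single:
  "p = (\<Sum>m\<in>Poly_Mapping.keys p. Poly_Mapping.single m (Poly_Mapping.lookup p m))"
  by (rule poly_mapping_eqI) (auto simp: lookup_sum lookup_single when_def in_keys_iff)

lemma poly_induct_single [case_names single add]:
  fixes p :: "'a \<Rightarrow>\<^sub>0 'b::comm_monoid_add"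
  assumes single: "\<And>m c. P (Poly_Mapping.single m c)"
    and add: "\<And>p q. P p \<Longrightarrow> P q \<Longrightarrow> P (p + q)"
  shows "P p"
proof -
  have "P (\<Sum>m\<in>M. Poly_Mapping.single m (Poly_Mapping.lookup p m))" if "finite M" for M
    using that
  proof (induction M)
    case empty
    \<comment> \<open>The zero polynomial counts as a term with coefficient \<open>0\<close>, at an
      arbitrary exponent.\<close>
    then show ?case using single[of undefined 0] by simp
  qed (simp add: single add)
  then show ?thesis
    by (subst poly_eq_sum_single) simp
qed

definition monom_subst :: "('n::finite, 'k::comm_semiring_1) polymap \<Rightarrow> ('n \<Rightarrow>\<^sub>0 nat) \<Rightarrow> ('n, 'k) mpoly"
  where "monom_subst G m = (\<Prod>i\<in>UNIV. (G $ i) ^ Poly_Mapping.lookup m i)"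

lemma monom_subst_0 [simp]: "monom_subst G 0 = 1"
  by (simp add: monom_subst_def)

lemma monom_subst_add: "monom_subst G (m + m') = monom_subst G m * monom_subst G m'"
  by (simp add: monom_subst_def lookup_add power_add prod.distrib)

lemma monom_subst_single: "monom_subst G (Poly_Mapping.single i k) = (G $ i) ^ k"
proof -
  have "monom_subst G (Poly_Mapping.single i k) = (\<Prod>j\<in>UNIV. if j = i then (G $ i) ^ k else 1)"
    unfolding monom_subst_def by (rule prod.cong) (auto simp: lookup_single when_def)
  then show ?thesis by simp
qed

text \<open>Cancellation can make the support of \<open>p + q\<close> smaller than the union of the
  supports. Summing over a common superset brings \<open>p\<close>, \<open>q\<close> and
  \<open>p + q\<close> into the same form.\<close>

lemma poly_subst_superset:
  assumes "finite M" "Poly_Mapping.keys p \<subseteq> M"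
  shows "poly_subst p G = (\<Sum>m\<in>M. Const (Poly_Mapping.lookup p m) * monom_subst G m)"
  unfolding poly_subst_def monom_subst_def
  by (rule sum.mono_neutral_left) (use assms in \<open>auto simp: in_keys_iff\<close>)

lemma poly_subst_single [simp]: "poly_subst (Poly_Mapping.single m c) G = Const c * monom_subst G m"
  by (subst poly_subst_superset[of "{m}"]) auto

lemma poly_subst_0 [simp]: "poly_subst 0 G = 0"
  by (simp add: poly_subst_def)

lemma poly_subst_add: "poly_subst (p + q) G = poly_subst p G + poly_subst q G"
proof -
  let ?M = "Poly_Mapping.keys p \<union> Poly_Mapping.keys q"
  have "Poly_Mapping.keys (p + q) \<subseteq> ?M" by (rule keys_add)
  then show ?thesis
    by (simp add: poly_subst_superset[where M = ?M] lookup_add Const_add distrib_right sum.distrib)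
qed

lemma poly_subst_Const [simp]: "poly_subst (Const c) G = Const c"
  using poly_subst_single[of 0 c G] by (simp add: Const_def)

lemma poly_subst_1 [simp]: "poly_subst 1 G = 1"
  using poly_subst_Const[of 1 G] by simp

lemma poly_subst_Var [simp]: "poly_subst (Var i) G = G $ i"
  by (simp add: Var_def monom_subst_single)

lemma id_polymap_nth [simp]: "id_polymap $ i = Var i"
  by (simp add: id_polymap_def)

lemma poly_subst_mult: "poly_subst (p * q) G = poly_subst p G * poly_subst q G"
proof (induction p rule: poly_induct_single)
  case (single m c)
  show ?case
  proof (induction q rule: poly_induct_single)
    case (single m' c')
    show ?case
      by (simp add: mult_single Const_mult monom_subst_add mult_ac)
  qed (simp add: poly_subst_add distrib_left)
qed (simp add: poly_subst_add distrib_right)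

lemma poly_subst_sum: "poly_subst (\<Sum>i\<in>I. f i) G = (\<Sum>i\<in>I. poly_subst (f i) G)"
  by (induction I rule: infinite_finite_induct) (simp_all add: poly_subst_add)

lemma poly_subst_prod: "poly_subst (\<Prod>i\<in>I. f i) G = (\<Prod>i\<in>I. poly_subst (f i) G)"
  by (induction I rule: infinite_finite_induct) (simp_all add: poly_subst_mult)

lemma poly_subst_power: "poly_subst (p ^ k) G = poly_subst p G ^ k"
  by (induction k) (simp_all add: poly_subst_mult)

text \<open>Both sides are additive and multiplicative in \<open>p\<close> and agree on constants
  and variables. Hence two mutually inverse polynomial maps give mutually inverse automorphisms of
  the polynomial ring.\<close>

lemma poly_subst_poly_subst: "poly_subst (poly_subst p F) G = poly_subst p (polymap_comp F G)"
proof (induction p rule: poly_induct_single)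
  case (single m c)
  show ?case
    by (simp add: poly_subst_mult monom_subst_def poly_subst_prod poly_subst_power polymap_comp_def)
qed (simp add: poly_subst_add)

lemma polymap_comp_assoc: "polymap_comp (polymap_comp F G) H = polymap_comp F (polymap_comp G H)"
  by (simp add: polymap_comp_def poly_subst_poly_subst vec_eq_iff)

lemma monom_subst_id: "monom_subst id_polymap m = Poly_Mapping.single m (1 :: 'k::comm_semiring_1)"
proof -
  have pow: "(Var i :: ('n, 'k) mpoly) ^ k = Poly_Mapping.single (Poly_Mapping.single i k) 1" for i k
    by (induction k) (simp_all add: Var_def mult_single add.commute One_nat_def flip: single_add)
  have "(\<Prod>i\<in>I. Poly_Mapping.single (f i) (1::'k)) = Poly_Mapping.single (\<Sum>i\<in>I. f i) 1"
    for f :: "'n \<Rightarrow> 'n \<Rightarrow>\<^sub>0 nat" and I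
    by (induction I rule: infinite_finite_induct) (simp_all add: mult_single)
  then have "monom_subst id_polymap m =
      Poly_Mapping.single (\<Sum>i\<in>UNIV. Poly_Mapping.single i (Poly_Mapping.lookup m i)) (1 :: 'k)"
    by (simp add: monom_subst_def id_polymap_def pow)
  also have "(\<Sum>i\<in>UNIV. Poly_Mapping.single i (Poly_Mapping.lookup m i)) = m"
    by (rule poly_mapping_eqI) (simp add: lookup_sum lookup_single when_def)
  finally show ?thesis .
qed

lemma poly_subst_id [simp]: "poly_subst p id_polymap = p"
proof (induction p rule: poly_induct_single)
  case (single m c)
  show ?case by (simp add: monom_subst_id Const_mult_single)
qed (simp add: poly_subst_add)

section \<open>Linear polynomial maps and matrix multiplication\<close>

lemma linear_forms_nth: "linear_forms A $ i = (\<Sum>j\<in>UNIV. Const (A $ i $ j) * Var j)"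
  by (simp add: linear_forms_def matrix_vector_mult_def id_polymap_def)

lemma poly_subst_linear_forms:
  "poly_subst (linear_forms A $ i) G = (\<Sum>j\<in>UNIV. Const (A $ i $ j) * G $ j)"
  by (simp add: linear_forms_nth poly_subst_sum poly_subst_mult)

lemma linear_forms_comp: "polymap_comp (linear_forms A) (linear_forms B) = linear_forms (A ** B)"
proof -
  have "poly_subst (linear_forms A $ i) (linear_forms B) = linear_forms (A ** B) $ i" for i
  proof -
    have "poly_subst (linear_forms A $ i) (linear_forms B) =
        (\<Sum>j\<in>UNIV. \<Sum>k\<in>UNIV. Const (A $ i $ j * B $ j $ k) * Var k)"
      unfolding poly_subst_linear_forms
      by (simp add: linear_forms_nth sum_distrib_left Const_mult mult.assoc)
    also have "\<dots> = (\<Sum>k\<in>UNIV. \<Sum>j\<in>UNIV. Const (A $ i $ j * B $ j $ k) * Var k)"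
      by (rule sum.swap)
    also have "\<dots> = linear_forms (A ** B) $ i"
      by (simp add: linear_forms_nth matrix_matrix_mult_def Const_sum sum_distrib_right)
    finally show ?thesis .
  qed
  then show ?thesis by (simp add: polymap_comp_def vec_eq_iff)
qed

lemma linear_forms_mat_1: "linear_forms (mat 1) = id_polymap"
  by (simp add: vec_eq_iff linear_forms_nth id_polymap_def mat_def if_distrib if_distribR cong: if_cong)

section \<open>Weighted degrees\<close>

text \<open>The weight function \<open>\<lambda>_. 1\<close> yields the ordinary degree. The other
  one that occurs gives weight \<open>1\<close> to the variables from \<open>S\<close> and
  \<open>d\<close> to the rest.\<close>

definition weight :: "('n::finite \<Rightarrow> nat) \<Rightarrow> ('n \<Rightarrow>\<^sub>0 nat) \<Rightarrow> nat"
  where "weight w m = (\<Sum>i\<in>UNIV. w i * Poly_Mapping.lookup m i)"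

lemma weight_0 [simp]: "weight w 0 = 0"
  by (simp add: weight_def)

lemma weight_add: "weight w (m + m') = weight w m + weight w m'"
  by (simp add: weight_def lookup_add distrib_left sum.distrib)

lemma weight_single [simp]: "weight w (Poly_Mapping.single i k) = w i * k"
proof -
  have "weight w (Poly_Mapping.single i k) = (\<Sum>j\<in>UNIV. if j = i then w i * k else 0)"
    unfolding weight_def by (rule sum.cong) (auto simp: lookup_single when_def)
  then show ?thesis by simp
qed

text \<open>A bound instead of a degree function makes the zero polynomial satisfy every estimate
  without an exception.\<close>

definition wdegree_le :: "('n::finite \<Rightarrow> nat) \<Rightarrow> nat \<Rightarrow> ('n, 'k::zero) mpoly \<Rightarrow> bool"
  where "wdegree_le w N p \<longleftrightarrow> (\<forall>m\<in>Poly_Mapping.keys p. weight w m \<le> N)"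

lemma wdegree_le_mono: "wdegree_le w N p \<Longrightarrow> N \<le> N' \<Longrightarrow> wdegree_le w N' p"
  by (auto simp: wdegree_le_def)

lemma wdegree_le_0 [simp]: "wdegree_le w N 0"
  by (simp add: wdegree_le_def)

lemma wdegree_le_Const [simp]: "wdegree_le w N (Const c)"
  by (simp add: wdegree_le_def Const_def)

lemma wdegree_le_1 [simp]: "wdegree_le w N (1 :: ('n::finite, 'k::comm_semiring_1) mpoly)"
  by (simp add: wdegree_le_def)

lemma wdegree_le_single: "weight w m \<le> N \<Longrightarrow> wdegree_le w N (Poly_Mapping.single m c)"
  by (simp add: wdegree_le_def)

lemma wdegree_le_Var: "w i \<le> N \<Longrightarrow> wdegree_le w N (Var i)"
  by (simp add: Var_def wdegree_le_single)

lemma wdegree_le_add: "wdegree_le w N p \<Longrightarrow> wdegree_le w N q \<Longrightarrow> wdegree_le w N (p + q)"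
  using keys_add[of p q] by (auto simp: wdegree_le_def)

lemma wdegree_le_sum: "(\<And>i. i \<in> I \<Longrightarrow> wdegree_le w N (f i)) \<Longrightarrow> wdegree_le w N (\<Sum>i\<in>I. f i)"
  by (induction I rule: infinite_finite_induct) (simp_all add: wdegree_le_add)

lemma wdegree_le_mult:
  fixes p q :: "('n::finite, 'k::comm_semiring_1) mpoly"
  assumes "wdegree_le w N p" "wdegree_le w N' q"
  shows "wdegree_le w (N + N') (p * q)"
proof -
  have "weight w m \<le> N + N'" if m: "m \<in> Poly_Mapping.keys (p * q)" for m
  proof -
    obtain a b where "m = a + b" "a \<in> Poly_Mapping.keys p" "b \<in> Poly_Mapping.keys q"
      using m keys_mult[of p q] by blast
    then show ?thesis using assms by (force simp: wdegree_le_def weight_add intro: add_mono)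
  qed
  then show ?thesis by (simp add: wdegree_le_def)
qed

lemma wdegree_le_Const_mult:
  fixes p :: "('n::finite, 'k::comm_semiring_1) mpoly"
  shows "wdegree_le w N p \<Longrightarrow> wdegree_le w N (Const c * p)"
  using wdegree_le_mult[of w 0 "Const c" N p] by simp

lemma wdegree_le_power:
  fixes p :: "('n::finite, 'k::comm_semiring_1) mpoly"
  shows "wdegree_le w N p \<Longrightarrow> wdegree_le w (k * N) (p ^ k)"
  by (induction k) (auto simp: wdegree_le_mult)

lemma wdegree_le_prod:
  fixes f :: "'i \<Rightarrow> ('n::finite, 'k::comm_semiring_1) mpoly"
  shows "(\<And>i. i \<in> I \<Longrightarrow> wdegree_le w (N i) (f i)) \<Longrightarrow> wdegree_le w (\<Sum>i\<in>I. N i) (\<Prod>i\<in>I. f i)"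
  by (induction I rule: infinite_finite_induct) (auto simp: wdegree_le_mult)

text \<open>Each variable, counted with multiplicity, contributes at most \<open>d\<close>. So
  substitution by \<open>F\<close> maps degree at most \<open>D\<close> to weighted degree at most
  \<open>d * D\<close>.\<close>

lemma wdegree_le_monom_subst:
  assumes "\<And>i. wdegree_le w d (F $ i)"
  shows "wdegree_le w (d * weight (\<lambda>_. 1) m) (monom_subst F m)"
proof -
  have "wdegree_le w (\<Sum>i\<in>UNIV. Poly_Mapping.lookup m i * d) (monom_subst F m)"
    unfolding monom_subst_def by (intro wdegree_le_prod wdegree_le_power assms)
  then show ?thesis by (simp add: weight_def mult.commute sum_distrib_left)
qed

lemma total_degree_le_iff: "total_degree p \<le> N \<longleftrightarrow> wdegree_le (\<lambda>_. 1) N p"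
  by (simp add: total_degree_def wdegree_le_def weight_def)

lemma total_degree_attained:
  assumes "p \<noteq> 0"
  obtains m where "m \<in> Poly_Mapping.keys p" "weight (\<lambda>_. 1) m = total_degree p"
proof -
  let ?D = "insert 0 ((\<lambda>m. \<Sum>i\<in>UNIV. Poly_Mapping.lookup m i) ` Poly_Mapping.keys p)"
  have "Max ?D \<in> ?D" by (rule Max_in) auto
  moreover have "Max ?D = total_degree p"
    by (simp add: total_degree_def)
  ultimately consider "total_degree p = 0" | "\<exists>m\<in>Poly_Mapping.keys p. weight (\<lambda>_. 1) m = total_degree p"
    by (force simp: weight_def)
  then show ?thesis
  proof cases
    \<comment> \<open>The maximum may be the inserted \<open>0\<close> and not come from a monomial;
      in degree \<open>0\<close> any monomial of \<open>p\<close> will do.\<close>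
    case 1
    obtain m where m: "m \<in> Poly_Mapping.keys p" using assms keys_eq_empty by blast
    moreover have "weight (\<lambda>_. 1) m \<le> 0"
      using 1 m total_degree_le_iff[of p 0] by (simp add: wdegree_le_def)
    ultimately show ?thesis using that 1 by simp
  qed (use that in blast)
qed

text \<open>All \<open>b i\<close> lie in the span of \<open>card J\<close> monomials. Independence
  is assumed for an indexed family, so \<open>b\<close> is first shown to be injective: two equal
  members would satisfy a relation with coefficients \<open>1\<close> and
  \<open>- 1\<close>.\<close>

lemma card_le_if_independent:
  fixes b :: "'i \<Rightarrow> ('n, 'k::field) mpoly"
  assumes "finite I" "finite J"
    and keys: "\<And>i. i \<in> I \<Longrightarrow> Poly_Mapping.keys (b i) \<subseteq> J"
    and indep: "\<And>c i. (\<Sum>i\<in>I. Const (c i) * b i) = 0 \<Longrightarrow> i \<in> I \<Longrightarrow> c i = 0"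
  shows "card I \<le> card J"
proof -
  interpret vector_space "\<lambda>c (p :: ('n, 'k) mpoly). Const c * p"
    by unfold_locales (simp_all add: Const_add Const_mult distrib_left distrib_right mult.assoc)
  have inj: "inj_on b I"
  proof (rule inj_onI, rule ccontr)
    fix i j assume ij: "i \<in> I" "j \<in> I" "b i = b j" "i \<noteq> j"
    let ?c = "\<lambda>k. if k = i then 1 else if k = j then - 1 else 0 :: 'k"
    have "(\<Sum>k\<in>I. Const (?c k) * b k) = (\<Sum>k\<in>{i, j}. Const (?c k) * b k)"
      by (rule sum.mono_neutral_right) (use \<open>finite I\<close> ij in auto)
    also have "\<dots> = 0"
      using ij(3,4) by (simp add: Const_uminus)
    finally have "?c i = 0"
      using indep[of ?c i] ij(1) by simp
    then show False by simp
  qed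
  have "independent (b ` I)"
  proof -
    have "u v = 0" if "(\<Sum>v\<in>b ` I. Const (u v) * v) = 0" "v \<in> b ` I" for u v
      using that indep[of "u \<circ> b"] by (auto simp: sum.reindex[OF inj])
    then show ?thesis
      using \<open>finite I\<close> by (subst dependent_finite) auto
  qed
  moreover have "b ` I \<subseteq> span ((\<lambda>m. Poly_Mapping.single m 1) ` J)"
  proof clarify
    fix i assume "i \<in> I"
    have "b i = (\<Sum>m\<in>Poly_Mapping.keys (b i).
        Const (Poly_Mapping.lookup (b i) m) * Poly_Mapping.single m 1)"
      by (subst poly_eq_sum_single) (simp add: Const_mult_single)
    also have "\<dots> \<in> span ((\<lambda>m. Poly_Mapping.single m 1) ` J)"
      using keys[OF \<open>i \<in> I\<close>] by (intro span_sum span_scale span_base) auto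
    finally show "b i \<in> span ((\<lambda>m. Poly_Mapping.single m 1) ` J)" .
  qed
  ultimately have "card (b ` I) \<le> card ((\<lambda>m. Poly_Mapping.single m (1 :: 'k)) ` J)"
    using independent_span_bound \<open>finite J\<close> by blast
  also have "\<dots> \<le> card J"
    using \<open>finite J\<close> by (rule card_image_le)
  finally show ?thesis
    by (simp add: card_image[OF inj])
qed

section \<open>Leading monomials of products\<close>

lemma leading_monomial:
  fixes p :: "('n::{finite,linorder}, 'k::comm_ring_1) mpoly"
  assumes "p \<noteq> 0"
  obtains a where "a \<in> Poly_Mapping.keys p" "weight (\<lambda>_. 1) a = total_degree p"
    "\<And>m. m \<in> Poly_Mapping.keys p \<Longrightarrow> weight (\<lambda>_. 1) m \<le> weight (\<lambda>_. 1) a"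
    "\<And>m. m \<in> Poly_Mapping.keys p \<Longrightarrow> weight (\<lambda>_. 1) m = weight (\<lambda>_. 1) a \<Longrightarrow> m \<le> a"
proof -
  define M where "M = {m \<in> Poly_Mapping.keys p. weight (\<lambda>_. 1) m = total_degree p}"
  have "finite M" "M \<noteq> {}"
    using total_degree_attained[OF assms] by (auto simp: M_def)
  then have "Max M \<in> M" by (rule Max_in)
  show ?thesis
  proof (rule that[of "Max M"])
    show "weight (\<lambda>_. 1) m \<le> weight (\<lambda>_. 1) (Max M)" if "m \<in> Poly_Mapping.keys p" for m
      using total_degree_le_iff[of p "total_degree p"] that \<open>Max M \<in> M\<close>
      by (auto simp: wdegree_le_def M_def)
    show "m \<le> Max M" if "m \<in> Poly_Mapping.keys p" "weight (\<lambda>_. 1) m = weight (\<lambda>_. 1) (Max M)" for m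
      using that \<open>Max M \<in> M\<close> \<open>finite M\<close> by (intro Max_ge) (auto simp: M_def)
  qed (use \<open>Max M \<in> M\<close> in \<open>auto simp: M_def\<close>)
qed

text \<open>
  The monomial \<open>a\<close> is the leading one for the graded lexicographic order: the order on exponent
  vectors alone is not graded, so \<open>leading_monomial\<close> maximizes the degree first.
\<close>

lemma monomial_of_mult:
  fixes p :: "('n::{finite,linorder}, 'k::idom) mpoly"
  assumes "p \<noteq> 0"
  obtains a where "weight (\<lambda>_. 1) a = total_degree p"
    "\<And>q. q \<noteq> 0 \<Longrightarrow> \<exists>b. a + b \<in> Poly_Mapping.keys (p * q)"
proof -
  obtain a where a: "a \<in> Poly_Mapping.keys p" "weight (\<lambda>_. 1) a = total_degree p"
    "\<And>m. m \<in> Poly_Mapping.keys p \<Longrightarrow> weight (\<lambda>_. 1) m \<le> weight (\<lambda>_. 1) a"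
    "\<And>m. m \<in> Poly_Mapping.keys p \<Longrightarrow> weight (\<lambda>_. 1) m = weight (\<lambda>_. 1) a \<Longrightarrow> m \<le> a"
    using leading_monomial[OF assms] by metis
  have "\<exists>b. a + b \<in> Poly_Mapping.keys (p * q)" if "q \<noteq> 0" for q
  proof -
    obtain b where b: "b \<in> Poly_Mapping.keys q"
      "\<And>m. m \<in> Poly_Mapping.keys q \<Longrightarrow> weight (\<lambda>_. 1) m \<le> weight (\<lambda>_. 1) b"
      "\<And>m. m \<in> Poly_Mapping.keys q \<Longrightarrow> weight (\<lambda>_. 1) m = weight (\<lambda>_. 1) b \<Longrightarrow> m \<le> b"
      using leading_monomial[OF \<open>q \<noteq> 0\<close>] by metis
    \<comment> \<open>Degrees add up, so \<open>x\<close> and \<open>y\<close> both have the maximal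
      degree, whence \<open>x \<le> a\<close> and \<open>y \<le> b\<close>. Strict monotonicity of
      addition then excludes a strict inequality.\<close>
    have unique: "x = a \<and> y = b"
      if "x \<in> Poly_Mapping.keys p" "y \<in> Poly_Mapping.keys q" "x + y = a + b" for x y
    proof -
      have "weight (\<lambda>_. 1) x + weight (\<lambda>_. 1) y = weight (\<lambda>_. 1) a + weight (\<lambda>_. 1) b"
        using \<open>x + y = a + b\<close> by (metis weight_add)
      then have "x \<le> a" "y \<le> b"
        using a(3,4)[OF that(1)] b(2,3)[OF that(2)] by linarith+
      then show ?thesis
        using \<open>x + y = a + b\<close> add_less_le_mono[of x a y b] add_le_less_mono[of x a y b]
        by (auto simp: le_less)
    qed
    \<comment> \<open>Splitting off the leading terms leaves the product of the leading coefficients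
      as the only contribution to the coefficient at \<open>a + b\<close>.\<close>
    let ?p = "p - Poly_Mapping.single a (Poly_Mapping.lookup p a)"
    let ?q = "q - Poly_Mapping.single b (Poly_Mapping.lookup q b)"
    have kp: "x \<in> Poly_Mapping.keys p \<and> x \<noteq> a" if "x \<in> Poly_Mapping.keys ?p" for x
      using that by (auto simp: in_keys_iff lookup_minus lookup_single when_def split: if_splits)
    have kq: "y \<in> Poly_Mapping.keys q \<and> y \<noteq> b" if "y \<in> Poly_Mapping.keys ?q" for y
      using that by (auto simp: in_keys_iff lookup_minus lookup_single when_def split: if_splits)
    have "a + b \<notin> Poly_Mapping.keys (?p * q)"
    proof
      assume "a + b \<in> Poly_Mapping.keys (?p * q)"
      then obtain x y where "a + b = x + y" "x \<in> Poly_Mapping.keys ?p" "y \<in> Poly_Mapping.keys q"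
        using keys_mult[of ?p q] by blast
      then show False using kp[of x] unique[of x y] by simp
    qed
    moreover have "a + b \<notin> Poly_Mapping.keys (Poly_Mapping.single a (Poly_Mapping.lookup p a) * ?q)"
    proof
      assume "a + b \<in> Poly_Mapping.keys (Poly_Mapping.single a (Poly_Mapping.lookup p a) * ?q)"
      then obtain x y where "a + b = x + y" "y \<in> Poly_Mapping.keys ?q"
          "x \<in> Poly_Mapping.keys (Poly_Mapping.single a (Poly_Mapping.lookup p a))"
        using keys_mult[of "Poly_Mapping.single a (Poly_Mapping.lookup p a)" ?q] by blast
      then show False using kq[of y] by (simp split: if_splits)
    qed
    moreover have "p * q = ?p * q + Poly_Mapping.single a (Poly_Mapping.lookup p a) * ?q
        + Poly_Mapping.single (a + b) (Poly_Mapping.lookup p a * Poly_Mapping.lookup q b)"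
      by (simp add: left_diff_distrib right_diff_distrib mult_single)
    ultimately have "Poly_Mapping.lookup (p * q) (a + b) = Poly_Mapping.lookup p a * Poly_Mapping.lookup q b"
      by (simp add: lookup_add in_keys_iff)
    also have "\<dots> \<noteq> 0"
      using a(1) b(1) by (simp add: in_keys_iff)
    finally show ?thesis
      by (auto simp: in_keys_iff)
  qed
  then show ?thesis using that a(2) by blast
qed

section \<open>Counting monomials\<close>

text \<open>Positive weights bound every exponent by \<open>N\<close>, so the monomials embed into a
  box. This crude bound, polynomial in \<open>N\<close>, is enough for
  \<open>growth_bound\<close>.\<close>

lemma finite_weight_le:
  assumes "\<And>i. w i > 0"
  shows "finite {m. weight w m \<le> N}"
    and "card {m :: 'n::finite \<Rightarrow>\<^sub>0 nat. weight w m \<le> N} \<le> (N + 1) ^ CARD('n)"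
proof -
  let ?X = "{m. weight w m \<le> N}" and ?Y = "PiE (UNIV :: 'n set) (\<lambda>_. {..N})"
  have sub: "Poly_Mapping.lookup ` ?X \<subseteq> ?Y"
  proof (intro image_subsetI PiE_I)
    fix m i assume "m \<in> ?X"
    have "Poly_Mapping.lookup m i \<le> w i * Poly_Mapping.lookup m i"
      using assms[of i] by (cases "w i") auto
    also have "\<dots> \<le> weight w m"
      unfolding weight_def by (rule member_le_sum) auto
    finally show "Poly_Mapping.lookup m i \<in> {..N}" using \<open>m \<in> ?X\<close> by simp
  qed simp
  have inj: "inj_on Poly_Mapping.lookup ?X"
    by (simp add: inj_on_def lookup_inject)
  have fin: "finite ?Y" by (rule finite_PiE) auto
  show "finite ?X"
    using inj sub fin by (rule inj_on_finite)
  have "card ?X = card (Poly_Mapping.lookup ` ?X)"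
    using inj by (simp add: card_image)
  also have "\<dots> \<le> card ?Y"
    using sub fin by (rule card_mono[rotated])
  finally show "card ?X \<le> (N + 1) ^ CARD('n)"
    by (simp add: card_PiE One_nat_def)
qed

abbreviation homog_count :: "'n::finite itself \<Rightarrow> nat \<Rightarrow> nat"
  where "homog_count _ k \<equiv> card {m :: 'n \<Rightarrow>\<^sub>0 nat. weight (\<lambda>_. 1) m = k}"

abbreviation degree_count :: "'n::finite itself \<Rightarrow> nat \<Rightarrow> nat"
  where "degree_count _ k \<equiv> card {m :: 'n \<Rightarrow>\<^sub>0 nat. weight (\<lambda>_. 1) m \<le> k}"

lemma finite_homog [simp]: "finite {m :: 'n::finite \<Rightarrow>\<^sub>0 nat. weight (\<lambda>_. 1) m = k}"
  by (rule finite_subset[OF _ finite_weight_le(1)[of "\<lambda>_. 1" k]]) auto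

text \<open>Multiplication by the \<open>j\<close>-th power of a fixed variable is injective on
  monomials.\<close>

lemma homog_count_mono: "homog_count TYPE('n::finite) k \<le> homog_count TYPE('n) (k + j)"
proof (rule card_inj_on_le)
  fix i :: 'n
  show "inj_on (\<lambda>m. m + Poly_Mapping.single i j) {m. weight (\<lambda>_. 1) m = k}"
    by (simp add: inj_on_def)
qed (auto simp: weight_add)

text \<open>Each of the \<open>j\<close> degrees after \<open>k\<close> contributes at least as many
  monomials as degree \<open>k\<close> itself.\<close>

lemma degree_count_add:
  "degree_count TYPE('n::finite) k + j * homog_count TYPE('n) k \<le> degree_count TYPE('n) (k + j)"
proof (induction j)
  case (Suc j)
  have "{m :: 'n \<Rightarrow>\<^sub>0 nat. weight (\<lambda>_. 1) m \<le> k + Suc j} =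
      {m. weight (\<lambda>_. 1) m \<le> k + j} \<union> {m. weight (\<lambda>_. 1) m = k + Suc j}"
    by auto
  then have "degree_count TYPE('n) (k + Suc j) = degree_count TYPE('n) (k + j) + homog_count TYPE('n) (k + Suc j)"
    by (simp add: card_Un_disjoint finite_weight_le(1) disjoint_iff)
  then show ?case
    using Suc homog_count_mono[of k "Suc j", where 'n = 'n] by simp
qed simp

text \<open>
  Otherwise the number of monomials of degree \<open>k\<close> would grow exponentially. Comparing degrees
  \<open>j * (n + 1) * \<delta>\<close> makes Bernoulli's inequality, raised to the power \<open>n + 1\<close>, sufficient.
\<close>

lemma growth_bound:
  fixes q \<delta> :: nat
  assumes "\<And>k. \<delta> * homog_count TYPE('n::finite) k \<le> q * homog_count TYPE('n) (k + \<delta>)"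
    and "q > 0"
  shows "\<delta> \<le> q"
proof (rule ccontr)
  assume "\<not> \<delta> \<le> q"
  let ?n = "CARD('n)"
  \<comment> \<open>This constant satisfies \<open>j * Suc ?n * \<delta> + 1 \<le> j * C\<close> for
    all \<open>j > 0\<close>.\<close>
  define C where "C = Suc ?n * \<delta> + 1"
  have h0: "homog_count TYPE('n) 0 = 1"
  proof -
    have "{m :: 'n \<Rightarrow>\<^sub>0 nat. weight (\<lambda>_. 1) m = 0} = {0}"
      by (auto simp: weight_def intro: poly_mapping_eqI)
    then show ?thesis by simp
  qed
  have iter: "\<delta> ^ k \<le> q ^ k * homog_count TYPE('n) (k * \<delta>)" for k
  proof (induction k)
    case (Suc k)
    have "\<delta> ^ Suc k \<le> q ^ k * (\<delta> * homog_count TYPE('n) (k * \<delta>))"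
      using mult_le_mono2[OF Suc, of \<delta>] by (simp add: mult_ac)
    also have "\<dots> \<le> q ^ k * (q * homog_count TYPE('n) (k * \<delta> + \<delta>))"
      by (intro mult_le_mono2 assms(1))
    finally show ?case by (simp add: mult_ac add.commute)
  qed (simp add: h0)
  have "homog_count TYPE('n) k \<le> (k + 1) ^ ?n" for k
    by (rule order_trans[OF card_mono finite_weight_le(2)[of "\<lambda>_. 1"]])
      (auto simp: finite_weight_le(1))
  then have iter': "\<delta> ^ k \<le> q ^ k * (k * \<delta> + 1) ^ ?n" for k
    by (rule order_trans[OF iter mult_le_mono2])
  \<comment> \<open>The lower bound grows with order \<open>n + 1\<close> in \<open>j\<close>, the
    upper bound from \<open>iter'\<close> only with order \<open>n\<close>. Cancelling
    \<open>j ^ n\<close> bounds every positive \<open>j\<close> by one constant, which is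
    absurd.\<close>
  have "real j \<le> real q ^ Suc ?n * real C ^ ?n" if "j > 0" for j
  proof -
    have "1 + real j / real q \<le> (1 + 1 / real q) ^ j"
      using Bernoulli_inequality[OF order_trans[of "- 1" 0 "1 / real q"], of j] by simp
    \<comment> \<open>Integrality enters here: \<open>\<delta> > q\<close> means
      \<open>\<delta> \<ge> q + 1\<close>.\<close>
    also have "\<dots> \<le> (real \<delta> / real q) ^ j"
      using \<open>\<not> \<delta> \<le> q\<close> \<open>q > 0\<close>
      by (intro power_mono) (auto simp: pos_le_divide_eq distrib_right)
    finally have "real j / real q \<le> (real \<delta> / real q) ^ j" by simp
    then have "(real j / real q) ^ Suc ?n \<le> ((real \<delta> / real q) ^ j) ^ Suc ?n"
      by (intro power_mono) auto
    also have "\<dots> = real (\<delta> ^ (j * Suc ?n)) / real (q ^ (j * Suc ?n))"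
      by (simp add: power_divide power_add flip: power_mult)
    also have "\<dots> \<le> real ((j * Suc ?n * \<delta> + 1) ^ ?n)"
      using iter'[of "j * Suc ?n"] \<open>q > 0\<close>
      by (simp only: pos_divide_le_eq of_nat_0_less_iff zero_less_power mult.commute flip: of_nat_mult)
    also have "\<dots> \<le> real ((j * C) ^ ?n)"
      unfolding of_nat_le_iff C_def using \<open>j > 0\<close> by (intro power_mono) (auto simp: algebra_simps)
    finally have "(real j / real q) ^ Suc ?n \<le> real j ^ ?n * real C ^ ?n"
      by (simp add: power_mult_distrib)
    then have "real j ^ ?n * real j \<le> real j ^ ?n * (real q ^ Suc ?n * real C ^ ?n)"
      using \<open>q > 0\<close> by (simp add: power_divide field_simps)
    then show ?thesis
      using \<open>j > 0\<close> by simp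
  qed
  from this[of "Suc (nat \<lceil>real q ^ Suc ?n * real C ^ ?n\<rceil>)"] show False
    by linarith
qed

text \<open>
  Division with remainder by \<open>d\<close> in the variables from \<open>S\<close>: for given remainders, the interval of
  weights has length \<open>d\<close> and hence determines the degree of the quotient, which is then padded to
  degree \<open>N + 1\<close> by a power of one variable.
\<close>

lemma weighted_count:
  fixes S :: "'n::finite set" and d N :: nat
  defines "w \<equiv> \<lambda>i. if i \<in> S then 1 else d"
  assumes "d > 0"
  shows "card {m. weight w m \<le> d * Suc N} \<le>
      card {m. weight w m \<le> d * N} + d ^ card S * homog_count TYPE('n) (Suc N)"
proof -
  let ?X = "{m. d * N < weight w m \<and> weight w m \<le> d * Suc N}"
  let ?R = "PiE S (\<lambda>_. {..<d})"
  define quo :: "('n \<Rightarrow>\<^sub>0 nat) \<Rightarrow> ('n \<Rightarrow>\<^sub>0 nat)"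
    where "quo m = Abs_poly_mapping (\<lambda>i. if i \<in> S then Poly_Mapping.lookup m i div d else Poly_Mapping.lookup m i)" for m
  define rem where "rem m = restrict (\<lambda>i. Poly_Mapping.lookup m i mod d) S" for m
  have lookup_quo: "Poly_Mapping.lookup (quo m) i =
      (if i \<in> S then Poly_Mapping.lookup m i div d else Poly_Mapping.lookup m i)" for m i
    by (simp add: quo_def)
  have weight_eq: "weight w m = d * weight (\<lambda>_. 1) (quo m) + (\<Sum>i\<in>S. rem m i)" for m
  proof -
    have "(\<Sum>i\<in>S. rem m i) = (\<Sum>i\<in>UNIV. if i \<in> S then Poly_Mapping.lookup m i mod d else 0)"
      by (simp add: rem_def sum.If_cases)
    then show ?thesis
      by (simp add: weight_def sum_distrib_left lookup_quo w_def flip: sum.distrib)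
        (auto intro!: sum.cong)
  qed
  define i0 :: 'n where "i0 = undefined"
  define f where "f m = (rem m, quo m + Poly_Mapping.single i0 (Suc N - weight (\<lambda>_. 1) (quo m)))" for m
  have le: "weight (\<lambda>_. 1) (quo m) \<le> Suc N" if "m \<in> ?X" for m
  proof -
    have "d * weight (\<lambda>_. 1) (quo m) \<le> d * Suc N"
      using that weight_eq[of m] by simp
    then show ?thesis using \<open>d > 0\<close> by (simp only: mult_le_cancel1)
  qed
  have "card ?X \<le> card (?R \<times> {m :: 'n \<Rightarrow>\<^sub>0 nat. weight (\<lambda>_. 1) m = Suc N})"
  proof (rule card_inj_on_le)
    show "inj_on f ?X"
    proof (rule inj_onI)
      fix x y assume xy: "x \<in> ?X" "y \<in> ?X" "f x = f y"
      then have rem: "rem x = rem y" by (simp add: f_def)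
      \<comment> \<open>The remainders agree and both weights lie in a half-open interval of length
        \<open>d\<close>. So the two multiples of \<open>d\<close> differ by less than
        \<open>d\<close>, and the padding powers in \<open>f\<close> coincide.\<close>
      have "d * weight (\<lambda>_. 1) (quo x) < d * Suc (weight (\<lambda>_. 1) (quo y))"
        "d * weight (\<lambda>_. 1) (quo y) < d * Suc (weight (\<lambda>_. 1) (quo x))"
        using xy(1,2) weight_eq[of x] weight_eq[of y] rem by auto
      then have "weight (\<lambda>_. 1) (quo x) = weight (\<lambda>_. 1) (quo y)"
        by (simp only: mult_less_cancel1) simp
      then have quo: "quo x = quo y"
        using xy(3) by (simp add: f_def)
      show "x = y"
      proof (rule poly_mapping_eqI)
        fix i
        show "Poly_Mapping.lookup x i = Poly_Mapping.lookup y i"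
        proof (cases "i \<in> S")
          case True
          have "Poly_Mapping.lookup x i div d = Poly_Mapping.lookup y i div d"
            using lookup_quo[of x i] lookup_quo[of y i] quo True by simp
          moreover have "Poly_Mapping.lookup x i mod d = Poly_Mapping.lookup y i mod d"
            using fun_cong[OF rem, of i] True by (simp add: rem_def)
          ultimately show ?thesis by (metis div_mod_decomp)
        next
          case False
          then show ?thesis using lookup_quo[of x i] lookup_quo[of y i] quo by simp
        qed
      qed
    qed
    show "f ` ?X \<subseteq> ?R \<times> {m. weight (\<lambda>_. 1) m = Suc N}"
      using le \<open>d > 0\<close> by (auto simp: f_def weight_add rem_def)
    show "finite (?R \<times> {m :: 'n \<Rightarrow>\<^sub>0 nat. weight (\<lambda>_. 1) m = Suc N})"
      by (intro finite_cartesian_product finite_PiE) auto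
  qed
  then have "card ?X \<le> d ^ card S * homog_count TYPE('n) (Suc N)"
    by (simp add: card_cartesian_product card_PiE)
  moreover have "{m. weight w m \<le> d * Suc N} = {m. weight w m \<le> d * N} \<union> ?X"
    by auto
  then have "card {m. weight w m \<le> d * Suc N} \<le> card {m. weight w m \<le> d * N} + card ?X"
    by (simp only: card_Un_le)
  ultimately show ?thesis by linarith
qed

section \<open>The degree bound\<close>

lemma total_degree_le_weighted:
  fixes F G :: "('n::{finite,linorder}, 'k::field) polymap" and S :: "'n set" and d :: nat
  defines "w \<equiv> \<lambda>i. if i \<in> S then 1 else d"
  assumes "d > 0"
    and inverse: "polymap_comp F G = id_polymap" "polymap_comp G F = id_polymap"
    and wF: "\<And>i. wdegree_le w d (F $ i)"
    and wP: "wdegree_le w d (poly_subst P F)"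
  shows "total_degree P \<le> d ^ card S"
proof (cases "total_degree P = 0")
  case False
  define \<delta> where "\<delta> = total_degree P"
  have "P \<noteq> 0" using False by (auto simp: total_degree_def)
  then obtain a where a: "weight (\<lambda>_. 1) a = \<delta>"
    and keys_mult: "\<And>q. q \<noteq> 0 \<Longrightarrow> \<exists>b. a + b \<in> Poly_Mapping.keys (P * q)"
    using monomial_of_mult unfolding \<delta>_def by metis
  have "\<delta> * homog_count TYPE('n) k \<le> d ^ card S * homog_count TYPE('n) (k + \<delta>)" for k
  proof -
    \<comment> \<open>Here \<open>k + \<delta>\<close> is the degree called \<open>D\<close> in the
      overview. It is positive because \<open>\<delta>\<close> is, which gives
      \<open>weighted_count\<close> its successor.\<close>
    obtain N where N: "k + \<delta> = Suc N"
      using False by (cases "k + \<delta>") (auto simp: \<delta>_def)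
    \<comment> \<open>\<open>U\<close> holds the monomials of degree at most \<open>D\<close> not
      divisible by \<open>a\<close>. \<open>W\<close> holds the multipliers of
      \<open>poly_subst P F\<close>, leaving room for its weighted degree \<open>d\<close>.
      \<open>J\<close> spans the space that contains all products and images.\<close>
    define U where "U = {m. weight (\<lambda>_. 1) m \<le> Suc N \<and> (\<forall>b. m \<noteq> a + b)}"
    define W where "W = {m. weight w m \<le> d * N}"
    define J where "J = {m. weight w m \<le> d * Suc N}"
    have "w i > 0" for i using \<open>d > 0\<close> by (simp add: w_def)
    then have fin: "finite U" "finite W" "finite J"
      by (auto simp: W_def J_def U_def intro: finite_weight_le(1)
          finite_subset[OF _ finite_weight_le(1)[of "\<lambda>_. 1" "Suc N"]])
    let ?b = "case_sum (monom_subst F) (\<lambda>m. poly_subst P F * Poly_Mapping.single m 1)"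
    have "card (U <+> W) \<le> card J"
    proof (rule card_le_if_independent[of _ _ ?b])
      fix i assume "i \<in> U <+> W"
      then show "Poly_Mapping.keys (?b i) \<subseteq> J"
      proof
        fix m assume m: "i = Inl m" "m \<in> U"
        have "wdegree_le w (d * Suc N) (monom_subst F m)"
          using m by (intro wdegree_le_mono[OF wdegree_le_monom_subst[OF wF]] mult_le_mono2) (simp add: U_def)
        then show ?thesis using m by (auto simp: J_def wdegree_le_def)
      next
        fix m assume m: "i = Inr m" "m \<in> W"
        have "wdegree_le w (d + d * N) (poly_subst P F * Poly_Mapping.single m 1)"
          using m by (intro wdegree_le_mult wP wdegree_le_single) (simp add: W_def)
        then show ?thesis using m by (auto simp: J_def wdegree_le_def)
      qed
    next
      fix c i
      assume zero: "(\<Sum>i\<in>U <+> W. Const (c i) * ?b i) = 0" and i: "i \<in> U <+> W"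
      \<comment> \<open>The two halves of the relation are collected into polynomials, so that it
        reads \<open>poly_subst u F + poly_subst P F * s = 0\<close>. The inverse substitution by
        \<open>G\<close> then exhibits \<open>u\<close> as a multiple of \<open>P\<close>.\<close>
      define u where "u = (\<Sum>m\<in>U. Poly_Mapping.single m (c (Inl m)))"
      define s where "s = (\<Sum>m\<in>W. Poly_Mapping.single m (c (Inr m)))"
      have "poly_subst P F * s = (\<Sum>m\<in>W. Const (c (Inr m)) * (poly_subst P F * Poly_Mapping.single m 1))"
        unfolding s_def sum_distrib_left
        by (rule sum.cong) (simp_all add: mult.left_commute Const_mult_single)
      then have "poly_subst u F + poly_subst P F * s = 0"
        using zero by (simp add: sum.Plus fin u_def poly_subst_sum)
      then have "poly_subst (poly_subst u F + poly_subst P F * s) G = 0" by simp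
      then have u: "u = - (P * poly_subst s G)"
        by (simp add: poly_subst_add poly_subst_mult poly_subst_poly_subst inverse eq_neg_iff_add_eq_0)
      have lookup_u: "Poly_Mapping.lookup u m = (if m \<in> U then c (Inl m) else 0)" for m
        using fin by (simp add: u_def lookup_sum lookup_single when_def)
      have lookup_s: "Poly_Mapping.lookup s m = (if m \<in> W then c (Inr m) else 0)" for m
        using fin by (simp add: s_def lookup_sum lookup_single when_def)
      \<comment> \<open>Otherwise this multiple of \<open>P\<close> would contain a monomial
        divisible by \<open>a\<close>, but \<open>u\<close> is supported on
        \<open>U\<close>.\<close>
      have "poly_subst s G = 0"
      proof (rule ccontr)
        assume "poly_subst s G \<noteq> 0"
        then obtain b where "a + b \<in> Poly_Mapping.keys (P * poly_subst s G)"
          using keys_mult by blast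
        then have "Poly_Mapping.lookup u (a + b) \<noteq> 0"
          by (simp add: u in_keys_iff)
        then show False
          by (simp add: lookup_u U_def split: if_splits)
      qed
      moreover have "s = poly_subst (poly_subst s G) F"
        by (simp add: poly_subst_poly_subst inverse)
      ultimately have "s = 0" "u = 0" by (simp_all add: u)
      show "c i = 0"
        using i lookup_u lookup_s \<open>s = 0\<close> \<open>u = 0\<close> by (auto elim!: PlusE) metis+
    qed (use fin in auto)
    \<comment> \<open>Since \<open>weighted_count\<close> bounds \<open>card J\<close> relative to
      \<open>card W\<close>, the size of \<open>W\<close> cancels and only a bound on
      \<open>card U\<close> remains.\<close>
    then have "card U + card W \<le> card W + d ^ card S * homog_count TYPE('n) (Suc N)"
      using weighted_count[OF \<open>d > 0\<close>, of S N] fin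
      by (simp add: card_Plus W_def J_def w_def)
    \<comment> \<open>A monomial of degree at most \<open>k + \<delta>\<close> outside
      \<open>U\<close> is \<open>a\<close> times one of degree at most \<open>k\<close>, as
      \<open>a\<close> has degree \<open>\<delta>\<close>.\<close>
    moreover have "degree_count TYPE('n) (Suc N) \<le> card U + degree_count TYPE('n) k"
    proof -
      have "{m. weight (\<lambda>_. 1) m \<le> Suc N} \<subseteq> U \<union> (+) a ` {m. weight (\<lambda>_. 1) m \<le> k}"
        using N by (auto simp: U_def weight_add a image_iff)
      then have "degree_count TYPE('n) (Suc N) \<le> card (U \<union> (+) a ` {m. weight (\<lambda>_. 1) m \<le> k})"
        by (intro card_mono) (simp_all add: fin finite_weight_le(1))
      also have "\<dots> \<le> card U + card ((+) a ` {m. weight (\<lambda>_. 1) m \<le> k})"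
        by (rule card_Un_le)
      also have "card ((+) a ` {m. weight (\<lambda>_. 1) m \<le> k}) = degree_count TYPE('n) k"
        by (rule card_image) simp
      finally show ?thesis by simp
    qed
    moreover have "degree_count TYPE('n) k + \<delta> * homog_count TYPE('n) k \<le> degree_count TYPE('n) (Suc N)"
      using degree_count_add[of k \<delta>, where 'n = 'n] N by simp
    ultimately show ?thesis
      using N by simp
  qed
  then have "\<delta> \<le> d ^ card S"
    by (rule growth_bound) (use \<open>d > 0\<close> in simp)
  then show ?thesis
    by (simp add: \<delta>_def)
qed simp

section \<open>The rank of the Jacobian matrix\<close>

lemma partial_deriv_superset:
  assumes "finite M" "Poly_Mapping.keys p \<subseteq> M"
  shows "partial_deriv j p = (\<Sum>m\<in>M. Poly_Mapping.single (m - Poly_Mapping.single j 1)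
    (of_nat (Poly_Mapping.lookup m j) * Poly_Mapping.lookup p m))"
  unfolding partial_deriv_def
  by (rule sum.mono_neutral_left) (use assms in \<open>auto simp: in_keys_iff\<close>)

lemma partial_deriv_single: "partial_deriv j (Poly_Mapping.single m c) =
    Poly_Mapping.single (m - Poly_Mapping.single j 1) (of_nat (Poly_Mapping.lookup m j) * c)"
  by (subst partial_deriv_superset[of "{m}"]) auto

lemma partial_deriv_add: "partial_deriv j (p + q) = partial_deriv j p + partial_deriv j q"
proof -
  let ?M = "Poly_Mapping.keys p \<union> Poly_Mapping.keys q"
  have "Poly_Mapping.keys (p + q) \<subseteq> ?M" by (rule keys_add)
  then show ?thesis
    by (simp add: partial_deriv_superset[where M = ?M] lookup_add distrib_left single_add sum.distrib)
qed

lemma partial_deriv_sum: "partial_deriv j (\<Sum>i\<in>I. f i) = (\<Sum>i\<in>I. partial_deriv j (f i))"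
proof (induction I rule: infinite_finite_induct)
  case (insert i I)
  then show ?case by (simp add: partial_deriv_add)
qed (simp_all add: partial_deriv_def)

lemma partial_deriv_mult:
  fixes p q :: "('n, 'k::comm_semiring_1) mpoly"
  shows "partial_deriv j (p * q) = partial_deriv j p * q + p * partial_deriv j q"
proof (induction p rule: poly_induct_single)
  case (single m c)
  show ?case
  proof (induction q rule: poly_induct_single)
    case (single m' c')
    \<comment> \<open>Truncated subtraction commutes with addition only if \<open>j\<close> occurs
      in \<open>x\<close>. In the remaining case the coefficient in the Leibniz rule is
      \<open>0\<close>.\<close>
    have shift: "x - Poly_Mapping.single j 1 + y = x + y - Poly_Mapping.single j 1"
      if "Poly_Mapping.lookup x j \<noteq> 0" for x y :: "'n \<Rightarrow>\<^sub>0 nat"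
      by (rule poly_mapping_eqI) (use that in \<open>auto simp: lookup_add lookup_minus lookup_single when_def\<close>)
    have 1: "Poly_Mapping.single (m - Poly_Mapping.single j 1 + m') (of_nat (Poly_Mapping.lookup m j) * c * c') =
        Poly_Mapping.single (m + m' - Poly_Mapping.single j 1) (of_nat (Poly_Mapping.lookup m j) * c * c')"
      using shift[of m m'] by (cases "Poly_Mapping.lookup m j = 0") auto
    have 2: "Poly_Mapping.single (m + (m' - Poly_Mapping.single j 1)) (c * (of_nat (Poly_Mapping.lookup m' j) * c')) =
        Poly_Mapping.single (m + m' - Poly_Mapping.single j 1) (c * (of_nat (Poly_Mapping.lookup m' j) * c'))"
      using shift[of m' m] by (cases "Poly_Mapping.lookup m' j = 0") (auto simp: add.commute)
    show ?case
      by (simp add: partial_deriv_single mult_single 1 2 lookup_add flip: single_add)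
        (simp add: distrib_left distrib_right mult_ac)
  qed (simp add: partial_deriv_add distrib_left add_ac)
qed (simp add: partial_deriv_add distrib_right add_ac)

lemma partial_deriv_power:
  fixes p :: "('n, 'k::comm_semiring_1) mpoly"
  assumes "d > 0"
  shows "partial_deriv j (p ^ d) = of_nat d * p ^ (d - 1) * partial_deriv j p"
  using assms
proof (induction d)
  case (Suc d)
  then show ?case
    by (cases d) (simp_all add: partial_deriv_mult distrib_right distrib_left mult_ac)
qed simp

lemma partial_deriv_linear_forms:
  fixes A :: "('n::finite, 'k::comm_semiring_1) sqmat"
  shows "partial_deriv j (linear_forms A $ i) = Const (A $ i $ j)"
proof -
  have "partial_deriv j (Const c * Var k) = (if k = j then Const c else 0)" for c :: 'k and k
    by (simp add: Var_def Const_mult_single partial_deriv_single lookup_single when_def)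
      (simp add: Const_def)
  then show ?thesis
    by (simp add: linear_forms_nth partial_deriv_sum)
qed

lemma linear_forms_eq_0_iff: "linear_forms A $ i = 0 \<longleftrightarrow> (\<forall>j. A $ i $ j = 0)"
proof
  assume "linear_forms A $ i = 0"
  then have "partial_deriv j (linear_forms A $ i) = 0" for j
    by (simp add: partial_deriv_def)
  then show "\<forall>j. A $ i $ j = 0"
    by (simp add: partial_deriv_linear_forms)
qed (simp add: linear_forms_nth)

text \<open>Over the field of rational functions, a diagonal matrix \<open>D\<close> turns the
  Jacobian matrix back into the constant matrix \<open>A\<close>, and \<open>L\<close> and
  \<open>T\<close> turn that into \<open>coord_proj S\<close>. Multiplication never raises the
  rank.\<close>

lemma card_le_rank_jacobian:
  fixes A L T :: "('n::{finite,linorder}, 'k::field_char_0) sqmat"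
  assumes "d > 0" and LAT: "L ** A ** T = coord_proj S"
  shows "card S \<le> poly_matrix_rank (jacobian (hadamard_power (linear_forms A) d))"
proof -
  \<comment> \<open>The embedding of constants carries the identity \<open>LAT\<close> to rational
    functions, which avoids comparing the ranks of \<open>A\<close> over two fields.\<close>
  define \<iota> :: "'k \<Rightarrow> ('n, 'k) mpoly fract" where "\<iota> c = Fract (Const c) 1" for c
  have \<iota>: "\<iota> 0 = 0" "\<iota> 1 = 1" "\<iota> (a + b) = \<iota> a + \<iota> b" "\<iota> (a * b) = \<iota> a * \<iota> b" for a b
    by (simp_all add: \<iota>_def Const_add Const_mult Zero_fract_def One_fract_def)
  have \<iota>_sum: "\<iota> (\<Sum>i\<in>I. f i) = (\<Sum>i\<in>I. \<iota> (f i))" for f :: "'n \<Rightarrow> 'k" and I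
    by (induction I rule: infinite_finite_induct) (simp_all add: \<iota>)
  define lift :: "('n, 'k) sqmat \<Rightarrow> ('n, ('n, 'k) mpoly fract) sqmat" where "lift M = (\<chi> i j. \<iota> (M $ i $ j))" for M
  have lift_mult: "lift (M ** N) = lift M ** lift N" for M N
    by (simp add: lift_def matrix_matrix_mult_def vec_eq_iff \<iota>_sum \<iota>)
  let ?J = "\<chi> i j. Fract (jacobian (hadamard_power (linear_forms A) d) $ i $ j) 1"
  define D :: "('n, ('n, 'k) mpoly fract) sqmat"
    where "D = (\<chi> i j. if i = j then inverse (Fract (of_nat d * (linear_forms A $ i) ^ (d - 1)) 1) else 0)"
  \<comment> \<open>If the \<open>i\<close>-th linear form vanishes, \<open>D\<close> may contain \<open>inverse 0 = 0\<close>, but then row \<open>i\<close> of \<open>A\<close> is zero.\<close>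
  have "(D ** ?J) $ i $ j = \<iota> (A $ i $ j)" for i j
  proof -
    let ?x = "of_nat d * (linear_forms A $ i) ^ (d - 1)"
    have "(D ** ?J) $ i $ j = inverse (Fract ?x 1) * (Fract ?x 1 * \<iota> (A $ i $ j))"
      using \<open>d > 0\<close> by (simp add: matrix_matrix_mult_def D_def jacobian_def hadamard_power_def \<iota>_def
        partial_deriv_power partial_deriv_linear_forms if_distribR if_distrib cong: if_cong)
    also have "\<dots> = \<iota> (A $ i $ j)"
    proof (cases "?x = 0")
      case True
      \<comment> \<open>In characteristic \<open>0\<close> the factor \<open>of_nat d\<close> is
        nonzero, so the power of the linear form must vanish.\<close>
      then have "linear_forms A $ i = 0" using \<open>d > 0\<close> by auto
      then show ?thesis by (simp add: linear_forms_eq_0_iff \<iota>)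
    next
      case False
      then have "Fract ?x 1 \<noteq> 0" by (simp add: Zero_fract_def eq_fract)
      then show ?thesis by (simp del: inverse_fract mult_fract flip: mult.assoc)
    qed
    finally show ?thesis .
  qed
  then have "lift A = D ** ?J" by (simp add: lift_def vec_eq_iff)
  moreover have "coord_proj S = lift (coord_proj S)"
    by (simp add: coord_proj_def lift_def vec_eq_iff \<iota>)
  ultimately have "coord_proj S = lift L ** (D ** ?J) ** lift T"
    by (simp add: lift_mult flip: LAT)
  then have "card S \<le> rank (lift L ** (D ** ?J) ** lift T)"
    by (metis card_le_rank_coord_proj)
  also have "\<dots> \<le> rank ?J"
    by (meson rank_mult_le_left rank_mult_le_right order_trans)
  finally show ?thesis by (simp add: poly_matrix_rank_def)
qed

section \<open>The degree bound for inverses of power linear maps\<close>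

theorem corollary3p5:
  fixes F H G :: "('n::{finite,linorder}, 'k::field_char_0) polymap"
    and A :: "('n, 'k) sqmat" and d r :: nat
  assumes "d \<ge> 1"
    and "H = hadamard_power (linear_forms A) d"
    and "F = id_polymap + H"
    and "is_polymap_inverse F G"
    and "poly_matrix_rank (jacobian H) = r"
  shows "polymap_degree G \<le> d ^ r"
proof -
  have "d > 0" using assms(1) by simp
  obtain T T' L :: "('n, 'k) sqmat" and S where T: "T ** T' = mat 1" "T' ** T = mat 1"
    and AT: "\<forall>i j. j \<notin> S \<longrightarrow> (A ** T) $ i $ j = 0" and L: "L ** A ** T = coord_proj S"
    using rank_normal_form[of A] by metis
  define w where "w = (\<lambda>i. if i \<in> S then 1 else d)"
  let ?F = "polymap_comp F (linear_forms T)" and ?G = "polymap_comp (linear_forms T') G"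
  have inv: "polymap_comp F G = id_polymap" "polymap_comp G F = id_polymap"
    using assms(4) by (simp_all add: is_polymap_inverse_def)
  have idl: "polymap_comp id_polymap X = X" and idr: "polymap_comp X id_polymap = X" for X :: "('n, 'k) polymap"
    by (simp_all add: polymap_comp_def vec_eq_iff)
  have "polymap_comp ?F ?G = polymap_comp (polymap_comp F (polymap_comp (linear_forms T) (linear_forms T'))) G"
    by (simp add: polymap_comp_assoc)
  then have FG: "polymap_comp ?F ?G = id_polymap"
    by (simp add: linear_forms_comp T linear_forms_mat_1 idr inv)
  have "polymap_comp ?G ?F = polymap_comp (linear_forms T') (polymap_comp (polymap_comp G F) (linear_forms T))"
    by (simp add: polymap_comp_assoc)
  then have GF: "polymap_comp ?G ?F = id_polymap"
    by (simp add: linear_forms_comp T linear_forms_mat_1 idl inv)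
  \<comment> \<open>The weight \<open>d\<close> outside \<open>S\<close> is the largest for which
    the linear part of \<open>?F\<close> keeps the bound \<open>d\<close> of the power part.\<close>
  have wT: "wdegree_le w d (linear_forms T $ i)" for i
    unfolding linear_forms_nth using \<open>d > 0\<close>
    by (intro wdegree_le_sum wdegree_le_Const_mult wdegree_le_Var) (simp add: w_def)
  \<comment> \<open>By \<open>AT\<close> only variables from \<open>S\<close>, of weight
    \<open>1\<close>, occur in these forms, so their \<open>d\<close>-th powers have weighted degree
    at most \<open>d\<close>.\<close>
  have wAT: "wdegree_le w 1 (linear_forms (A ** T) $ i)" for i
    unfolding linear_forms_nth
  proof (rule wdegree_le_sum)
    fix j
    show "wdegree_le w 1 (Const ((A ** T) $ i $ j) * Var j)"
    proof (cases "j \<in> S")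
      case True
      then show ?thesis by (intro wdegree_le_Const_mult wdegree_le_Var) (simp add: w_def)
    next
      case False
      then show ?thesis by (simp add: AT)
    qed
  qed
  have wF: "wdegree_le w d (?F $ i)" for i
  proof -
    have "poly_subst (linear_forms A $ i) (linear_forms T) = linear_forms (A ** T) $ i"
      by (simp add: polymap_comp_def flip: linear_forms_comp)
    then have "?F $ i = linear_forms T $ i + (linear_forms (A ** T) $ i) ^ d"
      by (simp add: assms(2,3) polymap_comp_def id_polymap_def hadamard_power_def poly_subst_add poly_subst_power)
    then show ?thesis
      using wdegree_le_power[OF wAT, of d i] by (simp add: wdegree_le_add wT)
  qed
  have "total_degree (G $ i) \<le> d ^ card S" for i
  proof (rule total_degree_le_weighted[OF \<open>d > 0\<close> FG GF])
    \<comment> \<open>Substituting \<open>?F\<close> into \<open>G $ i\<close> gives a component of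
      \<open>G\<close> after \<open>F\<close> after \<open>T\<close>, hence of \<open>T\<close>
      alone.\<close>
    have "poly_subst (G $ i) ?F = polymap_comp (polymap_comp G F) (linear_forms T) $ i"
      by (simp add: polymap_comp_assoc) (simp add: polymap_comp_def)
    then show "wdegree_le (\<lambda>i. if i \<in> S then 1 else d) d (poly_subst (G $ i) ?F)"
      using wT by (simp add: inv idl w_def)
  qed (use wF in \<open>simp add: w_def\<close>)
  moreover have "d ^ card S \<le> d ^ r"
    using card_le_rank_jacobian[OF \<open>d > 0\<close> L] assms(1,2,5) by (intro power_increasing) auto
  ultimately show ?thesis
    unfolding polymap_degree_def by (subst Max_le_iff) (auto intro: order_trans)
qed

end
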